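(* Let $\mathcal{X}\subseteq\mathbb{R}^n$ be nonempty and compact, let $B\in\mathbb{R}^{n\times r}$, $Q=BB^{\mathsf T}$, and let $P_B=\operatorname{conv}(B^{\mathsf T}\mathcal{X})\subseteq\mathbb{R}^r$. Let $x^\star$ be a maximizer of $x^{\mathsf T}Qx$ over $x\in\mathcal{X}$ and set $y^\star=B^{\mathsf T}x^\star$. Then, for every $y\in P_B$, $$\langle y^\star,y^\star-y\rangle=\frac12\Bigl(\lVert y^\star\rVert_2^2-\lVert y\rVert_2^2+\lVert y^\star-y\rVert_2^2\Bigr)\ge\frac12\lVert y^\star-y\rVert_2^2 .$$ Consequently, $y^\star$ is the unique maximizer of $y\mapsto\langle y^\star,y\rangle$ over $P_B$. Moreover, $x^\star\in\mathcal{O}_B(y^\star)$, and every $x\in\mathcal{O}_B(y^\star)$ satisfies $B^{\mathsf T}x=y^\star$ and is a global maximizer of $x^{\mathsf T}Qx$ over $\mathcal{X}$.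
   Context: For $z\in\mathbb{R}^r$, the set-valued rank-space linear oracle is $\mathcal{O}_B(z):=\{x\in\mathcal{X}: \langle z,B^{\mathsf T}x\rangle=\max_{x'\in\mathcal{X}}\langle z,B^{\mathsf T}x'\rangle\}$. Here $\langle\cdot,\cdot\rangle$ is the Euclidean inner product and $\operatorname{conv}$ is the convex hull. *)

theory Defs
  imports "HOL-Analysis.Analysis"
begin

definition rank_oracle ::
  "(real ^ 'n) set \<Rightarrow> real ^ 'r ^ 'n \<Rightarrow> real ^ 'r \<Rightarrow> (real ^ 'n) set"
  where
  \<comment> \<open>\<open>Max\<close> only covers finite sets, so the maximum is written as the greatest attained value;
      it exists whenever \<open>X\<close> is nonempty and compact.\<close>
  "rank_oracle X B z =
    {x \<in> X. z \<bullet> (transpose B *v x) =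
      (GREATEST v. v \<in> (\<lambda>x'. z \<bullet> (transpose B *v x')) ` X)}"

end

theory Submission
  imports Defs
begin

text \<open>
  As \<open>Q = B B\<^sup>T\<close>, the quadratic form at \<open>x\<close> is the squared norm of \<open>B\<^sup>T x\<close>, so \<open>ystar\<close> has
  maximal norm among the images \<open>B\<^sup>T x\<close>. Balls are convex, hence \<open>ystar\<close> has maximal norm on the
  hull \<open>P\<close> as well. Polarization then gives a gap \<open>ystar \<bullet> (ystar - y)\<close> of at least half the
  squared distance, which vanishes only at \<open>y = ystar\<close>.
\<close>

text \<open>The adjoint of \<open>B\<close> is its transpose, so the outer factor \<open>B\<close>
  can be moved to the other side of the inner product.\<close>

lemma inner_gram_matrix_vector:
  fixes B :: "real ^ 'r ^ 'n" and x :: "real ^ 'n"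
  shows "x \<bullet> ((B ** transpose B) *v x) = (norm (transpose B *v x))\<^sup>2"
  by (metis dot_lmul_matrix matrix_vector_mul_assoc power2_norm_eq_inner transpose_matrix_vector)

lemma inner_diff_polarization:
  fixes a b :: "'a :: real_inner"
  shows "a \<bullet> (a - b) = 1 / 2 * ((norm a)\<^sup>2 - (norm b)\<^sup>2 + (norm (a - b))\<^sup>2)"
  by (simp add: power2_norm_eq_inner inner_diff_left inner_diff_right inner_commute)

text \<open>\<open>cball 0 r\<close> is a convex set containing \<open>S\<close>, and the hull is
  the least such set.\<close>

lemma norm_convex_hull_le:
  fixes S :: "'a :: real_normed_vector set"
  assumes "\<And>s. s \<in> S \<Longrightarrow> norm s \<le> r" and "y \<in> convex hull S"
  shows "norm y \<le> r"
proof -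
  have "convex hull S \<subseteq> cball 0 r"
    using assms(1) by (intro hull_minimal) auto
  then show ?thesis
    using assms(2) by auto
qed

theorem theorem3p2:
  fixes X :: "(real ^ 'n) set"
    and B :: "real ^ 'r ^ 'n"
    and Q :: "real ^ 'n ^ 'n"
    and P :: "(real ^ 'r) set"
    and xstar :: "real ^ 'n"
    and ystar :: "real ^ 'r"
  assumes "X \<noteq> {}" and "compact X"
    and "Q = B ** transpose B"
    and "P = convex hull ((\<lambda>x. transpose B *v x) ` X)"
    and "is_arg_max (\<lambda>x. x \<bullet> (Q *v x)) (\<lambda>x. x \<in> X) xstar"
    and "ystar = transpose B *v xstar"
  shows "(\<forall>y\<in>P.
            ystar \<bullet> (ystar - y) =
              1 / 2 * ((norm ystar)\<^sup>2 - (norm y)\<^sup>2 + (norm (ystar - y))\<^sup>2) \<and>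
            1 / 2 * ((norm ystar)\<^sup>2 - (norm y)\<^sup>2 + (norm (ystar - y))\<^sup>2)
              \<ge> 1 / 2 * (norm (ystar - y))\<^sup>2) \<and>
         is_arg_max (\<lambda>y. ystar \<bullet> y) (\<lambda>y. y \<in> P) ystar \<and>
         (\<forall>y. is_arg_max (\<lambda>y. ystar \<bullet> y) (\<lambda>y. y \<in> P) y \<longrightarrow> y = ystar) \<and>
         xstar \<in> rank_oracle X B ystar \<and>
         (\<forall>x \<in> rank_oracle X B ystar.
            transpose B *v x = ystar \<and>
            is_arg_max (\<lambda>x. x \<bullet> (Q *v x)) (\<lambda>x. x \<in> X) x)"
proof -
  let ?f = "\<lambda>x. transpose B *v x"
  have Q: "x \<bullet> (Q *v x) = (norm (?f x))\<^sup>2" for x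
    unfolding assms(3) by (rule inner_gram_matrix_vector)
  have xX: "xstar \<in> X"
    using assms(5) by (simp add: is_arg_max_def)
  have norm_X: "norm (?f x) \<le> norm ystar" if "x \<in> X" for x
  proof -
    have "(norm (?f x))\<^sup>2 \<le> (norm ystar)\<^sup>2"
      using assms(5) that by (auto simp: is_arg_max_linorder Q assms(6))
    then show ?thesis
      by (simp add: power2_le_iff_abs_le)
  qed
  have norm_P: "norm y \<le> norm ystar" if "y \<in> P" for y
    by (rule norm_convex_hull_le[of "?f ` X"]) (use norm_X that assms(4) in auto)
  have f_P: "?f x \<in> P" if "x \<in> X" for x
    unfolding assms(4) using that by (intro hull_inc) auto
  have ystar_P: "ystar \<in> P"
    unfolding assms(6) using xX by (rule f_P)
  have bound: "1 / 2 * ((norm ystar)\<^sup>2 - (norm y)\<^sup>2 + (norm (ystar - y))\<^sup>2)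
      \<ge> 1 / 2 * (norm (ystar - y))\<^sup>2" if "y \<in> P" for y
    using power_mono[OF norm_P[OF that], of 2] by simp
  have gap: "1 / 2 * (norm (ystar - y))\<^sup>2 \<le> ystar \<bullet> (ystar - y)" if "y \<in> P" for y
    using bound[OF that] by (simp only: inner_diff_polarization)
  have le: "ystar \<bullet> y \<le> ystar \<bullet> ystar" if "y \<in> P" for y
  proof -
    have "0 \<le> ystar \<bullet> (ystar - y)"
      by (rule order_trans[OF _ gap[OF that]]) simp
    then show ?thesis
      by (simp add: inner_diff_right)
  qed
  \<comment> \<open>An inequality suffices as premise, so the fact serves both maximizers over
    \<open>P\<close> and images of oracle points.\<close>
  have unique: "y = ystar" if "y \<in> P" "ystar \<bullet> ystar \<le> ystar \<bullet> y" for y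
  proof -
    have "1 / 2 * (norm (ystar - y))\<^sup>2 \<le> 0"
      by (rule order_trans[OF gap[OF that(1)]]) (use that(2) in \<open>simp add: inner_diff_right\<close>)
    then show ?thesis
      by simp
  qed
  \<comment> \<open>The value is attained at \<open>xstar\<close>; \<open>le\<close> bounds all
    others, since every \<open>?f x\<close> with \<open>x\<close> in \<open>X\<close> lies in
    \<open>P\<close>.\<close>
  have greatest: "(GREATEST v. v \<in> (\<lambda>x. ystar \<bullet> ?f x) ` X) = ystar \<bullet> ystar"
    by (rule Greatest_equality) (use xX f_P le assms(6) in auto)
  have oracle_eq: "rank_oracle X B ystar = {x \<in> X. ystar \<bullet> ?f x = ystar \<bullet> ystar}"
    unfolding rank_oracle_def greatest ..
  have image_eq: "?f x = ystar" if "x \<in> rank_oracle X B ystar" for x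
    using that by (intro unique f_P) (simp_all add: oracle_eq)
  have maximizer: "is_arg_max (\<lambda>x. x \<bullet> (Q *v x)) (\<lambda>x. x \<in> X) x"
    if "x \<in> rank_oracle X B ystar" for x
    \<comment> \<open>By \<open>image_eq\<close>, the quadratic form at \<open>x\<close> equals the
      squared norm of \<open>ystar\<close>, which \<open>norm_X\<close> shows to be the largest
      value on \<open>X\<close>.\<close>
    using that image_eq[OF that] norm_X
    by (auto simp: is_arg_max_linorder Q oracle_eq intro!: power_mono)
  show ?thesis
  proof (intro conjI ballI allI impI)
    show "is_arg_max (\<lambda>y. ystar \<bullet> y) (\<lambda>y. y \<in> P) ystar"
      using ystar_P le by (simp add: is_arg_max_linorder)
    show "y = ystar" if "is_arg_max (\<lambda>y. ystar \<bullet> y) (\<lambda>y. y \<in> P) y" for y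
      using that ystar_P unique by (simp add: is_arg_max_linorder)
    show "xstar \<in> rank_oracle X B ystar"
      unfolding oracle_eq using xX assms(6) by simp
  \<comment> \<open>What remains is the identity and its lower bound on \<open>P\<close>, and the
    two claims about oracle points.\<close>
  qed (rule inner_diff_polarization | erule bound image_eq maximizer)+
qed

end
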